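(* Let $0\le\alpha<1$. Let $X_\alpha=C_1^{\alpha}[0,1]$ and $X_{1+\alpha}=C_1^{1+\alpha}[0,1]$ if $0<\alpha<1$, and let $X_0=C[0,1]$ and $X_1=C^1[0,1]$ if $\alpha=0$. Suppose $\mathcal G_\alpha$ is a dense $G_\delta$ set in $X_\alpha$. Then there exists a dense $G_\delta$ set $\mathcal G_{1+\alpha}$ in $X_{1+\alpha}$ such that for any $f\in\mathcal G_{1+\alpha}$ we have $f'\in\mathcal G_\alpha$.
   Context: For $0<\alpha<1$, $C_1^{\alpha}[0,1]$ is the set of functions $f:[0,1]\to\mathbb R$ with $|f(x)-f(y)|\le|x-y|^{\alpha}$ for all $x,y\in[0,1]$, with the metric $\|f-g\|_0$, where $\|h\|_0=\sup_{x\in[0,1]}|h(x)|$; and $C_1^{1+\alpha}[0,1]$ is the set of differentiable functions $f:[0,1]\to\mathbb R$ with $|f'(x)-f'(y)|\le|x-y|^{\alpha}$ for all $x,y\in[0,1]$, with the metric $\|f-g\|_1$, where $\|h\|_1=\max\{\|h\|_0,\|h'\|_0\}$. $C[0,1]$ is the space of continuous real functions with metric $\|f-g\|_0$, and $C^1[0,1]$ is the space of continuously differentiable real functions with metric $\|f-g\|_1$. *)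

theory Defs
  imports "HOL-Analysis.Analysis"
begin

text \<open>
  A real function on the unit interval is represented by an extensional function,
  i.e. one that takes the value \<open>undefined\<close> outside the interval, so that two such functions
  are equal iff they agree on the interval.
\<close>

definition unit_deriv :: "(real \<Rightarrow> real) \<Rightarrow> real \<Rightarrow> real" where
  "unit_deriv f = (\<lambda>x\<in>{0..1}. vector_derivative f (at x within {0..1}))"

text \<open>
  The sup metric; the library's \<open>cfunspace\<close> consists of bounded continuous maps, and here
  boundedness is automatic by compactness (see \<open>mspace_C0\<close> and \<open>mdist_C0\<close> below).
\<close>

definition C0_space :: "(real \<Rightarrow> real) metric" where
  "C0_space = cfunspace (top_of_set {0..1}) euclidean_metric"

definition C1_space :: "(real \<Rightarrow> real) metric" where
  "C1_space = metric
     ({f \<in> extensional {0..1}. (\<forall>x\<in>{0..1}. f differentiable (at x within {0..1}))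
                              \<and> continuous_on {0..1} (unit_deriv f)},
      \<lambda>f g. max (mdist C0_space f g) (mdist C0_space (unit_deriv f) (unit_deriv g)))"

definition hoelder1 :: "real \<Rightarrow> (real \<Rightarrow> real) \<Rightarrow> bool" where
  "hoelder1 \<alpha> f \<longleftrightarrow> (\<forall>x\<in>{0..1}. \<forall>y\<in>{0..1}. \<bar>f x - f y\<bar> \<le> \<bar>x - y\<bar> powr \<alpha>)"

text \<open>
  The Hoelder condition with positive exponent implies continuity, so restricting the
  spaces above imposes no additional requirement
  (see \<open>mspace_C0_hoelder\<close> and \<open>mspace_C1_hoelder\<close> below).
\<close>

definition C0_hoelder_space :: "real \<Rightarrow> (real \<Rightarrow> real) metric" where
  "C0_hoelder_space \<alpha> = submetric C0_space {f. hoelder1 \<alpha> f}"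

definition C1_hoelder_space :: "real \<Rightarrow> (real \<Rightarrow> real) metric" where
  "C1_hoelder_space \<alpha> = submetric C1_space {f. hoelder1 \<alpha> (unit_deriv f)}"

definition X_space :: "real \<Rightarrow> (real \<Rightarrow> real) metric" where
  "X_space \<alpha> = (if \<alpha> = 0 then C0_space else C0_hoelder_space \<alpha>)"

text \<open>The argument is \<open>\<alpha>\<close>, not \<open>1 + \<alpha>\<close>.\<close>

definition X1_space :: "real \<Rightarrow> (real \<Rightarrow> real) metric" where
  "X1_space \<alpha> = (if \<alpha> = 0 then C1_space else C1_hoelder_space \<alpha>)"

definition dense_gdelta_in :: "'a topology \<Rightarrow> 'a set \<Rightarrow> bool" where
  "dense_gdelta_in T G \<longleftrightarrow> gdelta_in T G \<and> T closure_of G = topspace T"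


subsection \<open>Explicit descriptions of the spaces\<close>

lemma mspace_C0: "mspace C0_space = {f \<in> extensional {0..1}. continuous_on {0..1} f}"
proof -
  have "bounded (f ` {0..1})" if "continuous_on {0..1::real} f" for f :: "real \<Rightarrow> real"
    by (simp add: compact_continuous_image compact_imp_bounded that)
  then show ?thesis
    unfolding C0_space_def
    by (auto simp: mbounded_iff_bounded mtopology_of_euclidean)
qed

lemma mdist_C0:
  assumes "f \<in> mspace C0_space" "g \<in> mspace C0_space"
  shows "mdist C0_space f g = (SUP x\<in>{0..1}. \<bar>f x - g x\<bar>)"
  using assms unfolding C0_space_def
  by (simp add: mdist_cfunspace_eq_mdist_funspace Met_TC.fdist_def Met_TC.fspace_def dist_real_def)

lemma unit_deriv_extensional [simp]: "unit_deriv f \<in> extensional {0..1}"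
  by (simp add: unit_deriv_def)

lemma unit_deriv_works:
  assumes "f differentiable (at x within {0..1})" "x \<in> {0..1}"
  shows "(f has_real_derivative unit_deriv f x) (at x within {0..1})"
  using assms by (simp add: unit_deriv_def has_real_derivative_iff_has_vector_derivative
      vector_derivative_works)

lemma Metric_space_C1:
  "Metric_space {f \<in> extensional {0..1}. (\<forall>x\<in>{0..1}. f differentiable (at x within {0..1}))
                              \<and> continuous_on {0..1} (unit_deriv f)}
     (\<lambda>f g. max (mdist C0_space f g) (mdist C0_space (unit_deriv f) (unit_deriv g)))"
proof -
  interpret C: Metric_space "mspace C0_space" "mdist C0_space" by simp
  have *: "f \<in> mspace C0_space \<and> unit_deriv f \<in> mspace C0_space"
    if "f \<in> extensional {0..1}" "\<forall>x\<in>{0..1}. f differentiable (at x within {0..1})"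
       "continuous_on {0..1} (unit_deriv f)" for f
    using that by (auto simp: mspace_C0 continuous_on_eq_continuous_within
        differentiable_imp_continuous_within)
  show ?thesis
  proof
    fix x y z
    assume "x \<in> {f \<in> extensional {0..1}. (\<forall>x\<in>{0..1}. f differentiable (at x within {0..1}))
                              \<and> continuous_on {0..1} (unit_deriv f)}"
      and "y \<in> {f \<in> extensional {0..1}. (\<forall>x\<in>{0..1}. f differentiable (at x within {0..1}))
                              \<and> continuous_on {0..1} (unit_deriv f)}"
      and "z \<in> {f \<in> extensional {0..1}. (\<forall>x\<in>{0..1}. f differentiable (at x within {0..1}))
                              \<and> continuous_on {0..1} (unit_deriv f)}"
    then have "mdist C0_space x z \<le> mdist C0_space x y + mdist C0_space y z"
      "mdist C0_space (unit_deriv x) (unit_deriv z)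
        \<le> mdist C0_space (unit_deriv x) (unit_deriv y) + mdist C0_space (unit_deriv y) (unit_deriv z)"
      using * by (auto intro!: C.triangle)
    then show "max (mdist C0_space x z) (mdist C0_space (unit_deriv x) (unit_deriv z))
       \<le> max (mdist C0_space x y) (mdist C0_space (unit_deriv x) (unit_deriv y))
        + max (mdist C0_space y z) (mdist C0_space (unit_deriv y) (unit_deriv z))"
      by linarith
  next
    fix x y
    assume x: "x \<in> {f \<in> extensional {0..1}. (\<forall>x\<in>{0..1}. f differentiable (at x within {0..1}))
                              \<and> continuous_on {0..1} (unit_deriv f)}"
      and y: "y \<in> {f \<in> extensional {0..1}. (\<forall>x\<in>{0..1}. f differentiable (at x within {0..1}))
                              \<and> continuous_on {0..1} (unit_deriv f)}"
    then have "x \<in> mspace C0_space" "y \<in> mspace C0_space"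
      "unit_deriv x \<in> mspace C0_space" "unit_deriv y \<in> mspace C0_space"
      using * by auto
    then show "max (mdist C0_space x y) (mdist C0_space (unit_deriv x) (unit_deriv y)) = 0 \<longleftrightarrow> x = y"
      by (metis C.nonneg C.zero max.cobounded1 max.idem order_antisym)
  qed (auto simp: C.commute max.coboundedI1)
qed

lemma mspace_C1:
  "mspace C1_space = {f \<in> extensional {0..1}. (\<forall>x\<in>{0..1}. f differentiable (at x within {0..1}))
                              \<and> continuous_on {0..1} (unit_deriv f)}"
  unfolding C1_space_def using Metric_space.mspace_metric [OF Metric_space_C1] .

lemma C1_imp_C0:
  assumes "f \<in> mspace C1_space"
  shows "f \<in> mspace C0_space" "unit_deriv f \<in> mspace C0_space"
  using assms by (auto simp: mspace_C0 mspace_C1 continuous_on_eq_continuous_within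
        differentiable_imp_continuous_within)

lemma unit_deriv_diff:
  assumes "f \<in> mspace C1_space" "g \<in> mspace C1_space" "x \<in> {0..1}"
  shows "unit_deriv (\<lambda>x. f x - g x) x = unit_deriv f x - unit_deriv g x"
proof -
  have "((\<lambda>x. f x - g x) has_real_derivative unit_deriv f x - unit_deriv g x) (at x within {0..1})"
    using assms by (intro DERIV_diff unit_deriv_works) (auto simp: mspace_C1)
  then show ?thesis
    using assms(3) vector_derivative_within_closed_interval [of 0 1 x]
    by (simp add: unit_deriv_def has_real_derivative_iff_has_vector_derivative)
qed

lemma mdist_C1:
  assumes "f \<in> mspace C1_space" "g \<in> mspace C1_space"
  shows "mdist C1_space f g =
    max (SUP x\<in>{0..1}. \<bar>f x - g x\<bar>) (SUP x\<in>{0..1}. \<bar>unit_deriv (\<lambda>x. f x - g x) x\<bar>)"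
proof -
  have "mdist C1_space f g
      = max (mdist C0_space f g) (mdist C0_space (unit_deriv f) (unit_deriv g))"
    unfolding C1_space_def Metric_space.mdist_metric [OF Metric_space_C1] ..
  moreover have "(SUP x\<in>{0..1}. \<bar>unit_deriv f x - unit_deriv g x\<bar>)
      = (SUP x\<in>{0..1}. \<bar>unit_deriv (\<lambda>x. f x - g x) x\<bar>)"
    using assms by (intro SUP_cong) (auto simp: unit_deriv_diff)
  ultimately show ?thesis
    using assms by (simp add: mdist_C0 C1_imp_C0)
qed

lemma hoelder1_imp_continuous_on:
  assumes "0 < \<alpha>" "hoelder1 \<alpha> f"
  shows "continuous_on {0..1} f"
  unfolding continuous_on_def
proof
  fix x :: real assume x: "x \<in> {0..1}"
  have "((\<lambda>y. y - x) \<longlongrightarrow> x - x) (at x within {0..1})"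
    by (intro tendsto_diff tendsto_ident_at tendsto_const)
  then have "((\<lambda>y. \<bar>y - x\<bar>) \<longlongrightarrow> 0) (at x within {0..1})"
    by (intro tendsto_rabs_zero) simp
  then have "((\<lambda>y. \<bar>y - x\<bar> powr \<alpha>) \<longlongrightarrow> 0 powr \<alpha>) (at x within {0..1})"
    using assms(1) by (intro tendsto_powr' [OF _ tendsto_const]) auto
  then have "((\<lambda>y. \<bar>y - x\<bar> powr \<alpha>) \<longlongrightarrow> 0) (at x within {0..1})" by simp
  moreover have "norm (f y - f x) \<le> \<bar>y - x\<bar> powr \<alpha>" if "y \<in> {0..1}" for y
    using assms(2) x that unfolding hoelder1_def real_norm_def by blast
  then have "\<forall>\<^sub>F y in at x within {0..1}. norm (f y - f x) \<le> \<bar>y - x\<bar> powr \<alpha>"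
    unfolding eventually_at_filter by (intro always_eventually allI impI)
  ultimately have "((\<lambda>y. f y - f x) \<longlongrightarrow> 0) (at x within {0..1})"
    by (rule Lim_null_comparison [rotated])
  then show "(f \<longlongrightarrow> f x) (at x within {0..1})"
    by (rule LIM_zero_cancel)
qed

lemma mspace_C0_hoelder:
  assumes "0 < \<alpha>"
  shows "mspace (C0_hoelder_space \<alpha>) =
    {f \<in> extensional {0..1}. \<forall>x\<in>{0..1}. \<forall>y\<in>{0..1}. \<bar>f x - f y\<bar> \<le> \<bar>x - y\<bar> powr \<alpha>}"
  using hoelder1_imp_continuous_on [OF assms]
  by (auto simp: C0_hoelder_space_def mspace_C0 hoelder1_def)

lemma mspace_C1_hoelder:
  assumes "0 < \<alpha>"
  shows "mspace (C1_hoelder_space \<alpha>) =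
    {f \<in> extensional {0..1}. (\<forall>x\<in>{0..1}. f differentiable (at x within {0..1})) \<and>
       (\<forall>x\<in>{0..1}. \<forall>y\<in>{0..1}. \<bar>unit_deriv f x - unit_deriv f y\<bar> \<le> \<bar>x - y\<bar> powr \<alpha>)}"
  using hoelder1_imp_continuous_on [OF assms]
  by (auto simp: C1_hoelder_space_def mspace_C1 hoelder1_def)

end

theory Submission
  imports Defs
begin

text \<open>
  Differentiation is a continuous open map from the space of functions \<open>f\<close> with \<open>f'\<close> in a given
  class \<open>S\<close> of continuous functions onto \<open>S\<close>, and the preimage of a dense \<open>G\<^sub>\<delta>\<close> set
  under a continuous open map is again a dense \<open>G\<^sub>\<delta>\<close> set: continuity pulls back \<open>G\<^sub>\<delta>\<close> sets,
  openness pulls back density. So \<open>{f. f' \<in> G}\<close> is the required set.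

  Continuity is immediate, as \<open>\<parallel>f' - g'\<parallel>\<^sub>0 \<le> \<parallel>f - g\<parallel>\<^sub>1\<close>. Openness holds because
  a perturbation of the derivative lifts to a perturbation of the function that is no larger: if
  \<open>g \<in> S\<close>, then \<open>h(x) = f(0) + \<integral>\<^sub>0\<^sup>x g\<close> has \<open>h' = g\<close>, and since \<open>h - f\<close> vanishes at \<open>0\<close>
  the mean value inequality gives \<open>\<parallel>h - f\<parallel>\<^sub>0 \<le> \<parallel>g - f'\<parallel>\<^sub>0\<close>, hence
  \<open>\<parallel>h - f\<parallel>\<^sub>1 = \<parallel>g - f'\<parallel>\<^sub>0\<close>. The class \<open>S\<close> enters only through the condition
  \<open>h' \<in> S\<close>, so one argument covers \<open>\<alpha> = 0\<close> (all continuous functions) and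
  \<open>0 < \<alpha> < 1\<close> (the Hoelder class).
\<close>

lemma gdelta_in_continuous_map_preimage:
  assumes "continuous_map X Y f" and "gdelta_in Y G"
  shows "gdelta_in X {x \<in> topspace X. f x \<in> G}"
proof -
  obtain C :: "nat \<Rightarrow> 'b set"
    where C: "\<And>n. openin Y (C n)" "\<And>n. C (Suc n) \<subseteq> C n" "\<Inter> (range C) = G"
    using assms(2) unfolding gdelta_in_descending by blast
  show ?thesis
    unfolding gdelta_in_descending
  proof (intro exI conjI allI)
    fix n
    show "openin X {x \<in> topspace X. f x \<in> C n}"
      using assms(1) C(1) by (rule openin_continuous_map_preimage)
    show "{x \<in> topspace X. f x \<in> C (Suc n)} \<subseteq> {x \<in> topspace X. f x \<in> C n}"
      using C(2) by blast
    show "(\<Inter>n. {x \<in> topspace X. f x \<in> C n}) = {x \<in> topspace X. f x \<in> G}"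
      using C(3) by auto
  qed
qed

text \<open>
  Every nonempty open set has a nonempty open image, which meets the dense set; a preimage of
  the common point lies in the open set.
\<close>
lemma dense_open_map_preimage:
  assumes "open_map X Y f" and "Y closure_of G = topspace Y"
  shows "X closure_of {x \<in> topspace X. f x \<in> G} = topspace X"
proof (intro equalityI closure_of_subset_topspace subsetI)
  fix x assume x: "x \<in> topspace X"
  show "x \<in> X closure_of {x \<in> topspace X. f x \<in> G}"
    unfolding in_closure_of
  proof (intro conjI allI impI x)
    fix U assume U: "x \<in> U \<and> openin X U"
    then have "openin Y (f ` U)"
      using assms(1) by (simp add: open_map_def)
    moreover from this have "f x \<in> Y closure_of G"
      unfolding assms(2) using U by (meson imageI openin_subset subsetD)
    ultimately obtain y where "y \<in> G" "y \<in> f ` U"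
      using U unfolding in_closure_of by blast
    then show "\<exists>y. y \<in> {x \<in> topspace X. f x \<in> G} \<and> y \<in> U"
      using U openin_subset by blast
  qed
qed

lemma dense_gdelta_in_preimage:
  assumes "continuous_map X Y f" "open_map X Y f" "dense_gdelta_in Y G"
  shows "dense_gdelta_in X {x \<in> topspace X. f x \<in> G}"
  using assms unfolding dense_gdelta_in_def
  by (simp add: gdelta_in_continuous_map_preimage dense_open_map_preimage)

text \<open>
  The lifting hypothesis says that the image of the ball of radius \<open>r\<close> around \<open>x\<close> contains
  the ball of radius \<open>r\<close> around \<open>f x\<close>.
\<close>
lemma open_map_if_lifting:
  assumes f: "f \<in> mspace m1 \<rightarrow> mspace m2"
    and lift: "\<And>x y. \<lbrakk>x \<in> mspace m1; y \<in> mspace m2\<rbrakk>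
      \<Longrightarrow> \<exists>z \<in> mspace m1. f z = y \<and> mdist m1 x z \<le> mdist m2 (f x) y"
  shows "open_map (mtopology_of m1) (mtopology_of m2) f"
proof -
  interpret M1: Metric_space "mspace m1" "mdist m1" by simp
  interpret M2: Metric_space "mspace m2" "mdist m2" by simp
  show ?thesis
    unfolding open_map_def mtopology_of_def
  proof (intro allI impI)
    fix U assume "openin M1.mtopology U"
    then have sub: "U \<subseteq> mspace m1"
      and ball: "\<And>x. x \<in> U \<Longrightarrow> \<exists>r>0. M1.mball x r \<subseteq> U"
      by (auto simp: M1.openin_mtopology)
    show "openin M2.mtopology (f ` U)"
      unfolding M2.openin_mtopology
    proof (intro conjI allI impI)
      show "f ` U \<subseteq> mspace m2" using f sub by blast
      fix w assume "w \<in> f ` U"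
      then obtain x where x: "x \<in> U" "w = f x" by blast
      then obtain r where r: "r > 0" "M1.mball x r \<subseteq> U" using ball by blast
      have "M2.mball w r \<subseteq> f ` U"
      proof
        fix y assume y: "y \<in> M2.mball w r"
        then obtain z where "z \<in> mspace m1" "f z = y" "mdist m1 x z \<le> mdist m2 (f x) y"
          using lift[of x y] x sub by auto
        then have "z \<in> M1.mball x r" using x sub y by auto
        then show "y \<in> f ` U" using r \<open>f z = y\<close> by blast
      qed
      then show "\<exists>r>0. M2.mball w r \<subseteq> f ` U" using r by blast
    qed
  qed
qed

lemma mdist_C1_eq_max_mdist_C0:
  "mdist C1_space f g = max (mdist C0_space f g) (mdist C0_space (unit_deriv f) (unit_deriv g))"
  unfolding C1_space_def Metric_space.mdist_metric [OF Metric_space_C1] ..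

lemma abs_diff_le_mdist_C0:
  assumes "f \<in> mspace C0_space" "g \<in> mspace C0_space" "x \<in> {0..1}"
  shows "\<bar>f x - g x\<bar> \<le> mdist C0_space f g"
proof -
  have "continuous_on {0..1} (\<lambda>x. \<bar>f x - g x\<bar>)"
    using assms by (auto simp: mspace_C0 intro!: continuous_intros)
  then have "bdd_above ((\<lambda>x. \<bar>f x - g x\<bar>) ` {0..1})"
    by (intro bounded_imp_bdd_above compact_imp_bounded compact_continuous_image compact_Icc)
  then show ?thesis
    unfolding mdist_C0 [OF assms(1,2)] using assms(3) by (intro cSUP_upper)
qed

lemma unit_deriv_eqI:
  assumes "x \<in> {0..1}" "(f has_real_derivative d) (at x within {0..1})"
  shows "unit_deriv f x = d"
  using assms vector_derivative_within_closed_interval [of 0 1 x f d]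
  by (simp add: unit_deriv_def has_real_derivative_iff_has_vector_derivative)

text \<open>
  The mean value inequality for \<open>f - g\<close>: differentiation does not lose distance between functions
  with the same initial value.
\<close>
lemma mdist_C0_le_mdist_unit_deriv:
  assumes f: "f \<in> mspace C1_space" and g: "g \<in> mspace C1_space" and "f 0 = g 0"
  shows "mdist C0_space f g \<le> mdist C0_space (unit_deriv f) (unit_deriv g)"
    (is "_ \<le> ?B")
proof -
  have "\<bar>f x - g x\<bar> \<le> ?B" if x: "x \<in> {0..1}" for x
  proof -
    have der: "((\<lambda>x. f x - g x) has_real_derivative unit_deriv f y - unit_deriv g y)
        (at y within {0..1})" if "y \<in> {0..1}" for y
      using f g that by (intro DERIV_diff unit_deriv_works) (auto simp: mspace_C1)
    have bound: "\<bar>unit_deriv f y - unit_deriv g y\<bar> \<le> ?B" if "y \<in> {0..1}" for y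
      using f g that by (intro abs_diff_le_mdist_C0 C1_imp_C0)
    have "norm ((f x - g x) - (f 0 - g 0)) \<le> ?B * norm (x - 0)"
      using der bound x
      by (intro field_differentiable_bound[where S = "{0..1}"
            and f' = "\<lambda>y. unit_deriv f y - unit_deriv g y"]) auto
    also have "\<dots> \<le> ?B * 1"
      using x by (intro mult_left_mono) auto
    finally show ?thesis using \<open>f 0 = g 0\<close> by simp
  qed
  then show ?thesis
    unfolding mdist_C0 [OF C1_imp_C0(1)[OF f] C1_imp_C0(1)[OF g]]
    by (intro cSUP_least) auto
qed

lemma C1_antiderivative_exists:
  assumes g: "g \<in> mspace C0_space"
  obtains h where "h \<in> mspace C1_space" "unit_deriv h = g" "h 0 = c"
proof
  define h where "h = (\<lambda>x\<in>{0..1::real}. c + integral {0..x} g)"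
  have int_der: "((\<lambda>x. c + integral {0..x} g) has_real_derivative g x) (at x within {0..1})"
    if "x \<in> {0..1}" for x
    using DERIV_add[OF DERIV_const integral_has_real_derivative[of 0 1 g x]] g that
    by (simp add: mspace_C0)
  have der: "(h has_real_derivative g x) (at x within {0..1})" if "x \<in> {0..1}" for x
    by (rule has_field_derivative_transform_within[where d = 1, OF int_der[OF that]])
      (use that in \<open>auto simp: h_def\<close>)
  show deriv: "unit_deriv h = g"
  proof (rule extensionalityI)
    show "unit_deriv h x = g x" if "x \<in> {0..1}" for x
      using that der[OF that] by (rule unit_deriv_eqI)
  qed (use g in \<open>auto simp: mspace_C0\<close>)
  show "h \<in> mspace C1_space"
    unfolding mspace_C1
  proof (intro CollectI conjI ballI)
    show "h \<in> extensional {0..1}" by (simp add: h_def)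
    show "h differentiable (at x within {0..1})" if "x \<in> {0..1}" for x
      using der[OF that] real_differentiable_def by blast
    show "continuous_on {0..1} (unit_deriv h)" using g by (simp add: deriv mspace_C0)
  qed
  show "h 0 = c" by (simp add: h_def)
qed

context
  fixes S :: "(real \<Rightarrow> real) set"
begin

lemma unit_deriv_funcset:
  "unit_deriv \<in> mspace (submetric C1_space {f. unit_deriv f \<in> S}) \<rightarrow> mspace (submetric C0_space S)"
  by (auto simp: C1_imp_C0)

lemma continuous_map_unit_deriv:
  "continuous_map (mtopology_of (submetric C1_space {f. unit_deriv f \<in> S}))
     (mtopology_of (submetric C0_space S)) unit_deriv"
proof (rule Lipschitz_continuous_imp_continuous_map)
  show "Lipschitz_continuous_map (submetric C1_space {f. unit_deriv f \<in> S})
      (submetric C0_space S) unit_deriv"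
    unfolding Lipschitz_continuous_map_def
    by (intro conjI exI[of _ 1] unit_deriv_funcset) (auto simp: mdist_C1_eq_max_mdist_C0)
qed

lemma open_map_unit_deriv:
  "open_map (mtopology_of (submetric C1_space {f. unit_deriv f \<in> S}))
     (mtopology_of (submetric C0_space S)) unit_deriv"
proof (rule open_map_if_lifting [OF unit_deriv_funcset])
  fix f g
  assume f: "f \<in> mspace (submetric C1_space {f. unit_deriv f \<in> S})"
    and g: "g \<in> mspace (submetric C0_space S)"
  then obtain h where h: "h \<in> mspace C1_space" "unit_deriv h = g" "h 0 = f 0"
    using C1_antiderivative_exists[of g "f 0"] by auto
  then have "mdist C0_space f h \<le> mdist C0_space (unit_deriv f) g"
    using f mdist_C0_le_mdist_unit_deriv[of f h] by auto
  then show "\<exists>h \<in> mspace (submetric C1_space {f. unit_deriv f \<in> S}). unit_deriv h = g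
      \<and> mdist (submetric C1_space {f. unit_deriv f \<in> S}) f h
          \<le> mdist (submetric C0_space S) (unit_deriv f) g"
    using g h by (intro bexI[of _ h]) (auto simp: mdist_C1_eq_max_mdist_C0)
qed

end

theorem theorem8:
  fixes \<alpha> :: real and G :: "(real \<Rightarrow> real) set"
  assumes "0 \<le> \<alpha>" and "\<alpha> < 1"
    and "dense_gdelta_in (mtopology_of (X_space \<alpha>)) G"
  shows "\<exists>G1. dense_gdelta_in (mtopology_of (X1_space \<alpha>)) G1 \<and> (\<forall>f\<in>G1. unit_deriv f \<in> G)"
proof -
  define S where "S = (if \<alpha> = 0 then UNIV else {f. hoelder1 \<alpha> f})"
  have X: "X_space \<alpha> = submetric C0_space S"
    by (simp add: X_space_def C0_hoelder_space_def S_def)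
  have X1: "X1_space \<alpha> = submetric C1_space {f. unit_deriv f \<in> S}"
    by (simp add: X1_space_def C1_hoelder_space_def S_def)
  have "dense_gdelta_in (mtopology_of (X1_space \<alpha>))
      {f \<in> topspace (mtopology_of (X1_space \<alpha>)). unit_deriv f \<in> G}"
    using assms(3) unfolding X X1
    by (rule dense_gdelta_in_preimage [OF continuous_map_unit_deriv open_map_unit_deriv])
  then show ?thesis by blast
qed

end
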